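(* Suppose that $n\ge 2$, $0\le s<n$ and $(n,s)\ne(2,0)$. Then the hypersurface $X_s\subset\mathbb{P}^n$ is rational (i.e. birational over $k$ to $\mathbb{P}^{n-1}$).
   Context: $k$ is an algebraically closed field of characteristic $p>0$, and $q$ is a power of $p$ (so $q=p^e$ with $e\ge 1$). $I_s$ is the $s\times s$ identity matrix, $E_r$ is the $r\times r$ matrix with entries $1$ on the subdiagonal (positions $(i+1,i)$) and $0$ elsewhere ($E_1=(0)$), and $W_s=\left(\begin{array}{c|c} I_s & 0\\ \hline 0 & E_{n-s+1}\end{array}\right)$, an $(n+1)\times(n+1)$ matrix. Writing $W_s=(a_{ij})_{0\le i,j\le n}$, $X_s$ is the hypersurface of degree $q+1$ in $\mathbb{P}^n$, with homogeneous coordinates $(x_0,\dots,x_n)$, defined by $\sum_{i,j}a_{ij}x_ix_j^q=0$. *)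

theory Defs
  imports
    "HOL-Library.Poly_Mapping"
    "HOL-Computational_Algebra.Polynomial"
    "HOL-Computational_Algebra.Factorial_Ring"
    "HOL-Analysis.Function_Topology"
    "Jordan_Normal_Form.Matrix"
begin

section \<open>Polynomials in several variables\<close>

text \<open>Polynomials in the variables \<open>x\<^sub>0, x\<^sub>1, x\<^sub>2, \<dots>\<close>: finitely supported maps from
  exponent vectors to coefficients. The ring \<open>k[x\<^sub>0, \<dots>, x\<^sub>n]\<close> is the part
  of this ring where only the variables \<open>x\<^sub>i\<close> with \<open>i \<le> n\<close> occur.\<close>

type_synonym 'k mpoly = "(nat \<Rightarrow>\<^sub>0 nat) \<Rightarrow>\<^sub>0 'k"

definition Var :: "nat \<Rightarrow> 'k::comm_ring_1 mpoly" where
  "Var i = Poly_Mapping.single (Poly_Mapping.single i 1) 1"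

definition Const :: "'k::comm_ring_1 \<Rightarrow> 'k mpoly" where
  "Const c = Poly_Mapping.single 0 c"

definition insertion :: "(nat \<Rightarrow> 'k) \<Rightarrow> 'k::comm_ring_1 mpoly \<Rightarrow> 'k" where
  "insertion x F =
     (\<Sum>m\<in>Poly_Mapping.keys F. Poly_Mapping.lookup F m *
        (\<Prod>i\<in>Poly_Mapping.keys m. x i ^ Poly_Mapping.lookup m i))"

text \<open>Homogeneous polynomials of degree \<open>d\<close> in \<open>k[x\<^sub>0, \<dots>, x\<^sub>n]\<close>, including \<open>0\<close>.\<close>

definition forms :: "nat \<Rightarrow> nat \<Rightarrow> 'k::comm_ring_1 mpoly set" where
  "forms n d = {F. \<forall>m\<in>Poly_Mapping.keys F. Poly_Mapping.keys m \<subseteq> {..n} \<and>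
     (\<Sum>i\<in>Poly_Mapping.keys m. Poly_Mapping.lookup m i) = d}"


section \<open>Projective space and birational equivalence\<close>

text \<open>The set of \<open>k\<close>-points of projective \<open>n\<close>-space. A coordinate vector
  \<open>(x\<^sub>0, \<dots>, x\<^sub>n)\<close> is a function on the naturals that is \<open>0\<close> beyond \<open>n\<close>; a point is the set
  of all its coordinate vectors.\<close>

definition hcoords :: "nat \<Rightarrow> (nat \<Rightarrow> 'k::field) set" where
  "hcoords n = {x. (\<forall>i>n. x i = 0) \<and> (\<exists>i\<le>n. x i \<noteq> 0)}"

definition proportional :: "nat \<Rightarrow> ((nat \<Rightarrow> 'k::field) \<times> (nat \<Rightarrow> 'k)) set" where
  "proportional n =
     {(x, y). x \<in> hcoords n \<and> y \<in> hcoords n \<and> (\<exists>c. c \<noteq> 0 \<and> y = (\<lambda>i. c * x i))}"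

type_synonym 'k point = "(nat \<Rightarrow> 'k) set"

definition proj_space :: "nat \<Rightarrow> 'k::field point set" where
  "proj_space n = hcoords n // proportional n"

definition zero_locus :: "nat \<Rightarrow> 'k::field mpoly \<Rightarrow> 'k point set" where
  "zero_locus n F = {P \<in> proj_space n. \<forall>x\<in>P. insertion x F = 0}"

text \<open>The complements of the zero loci of forms are closed under finite intersections (multiply
  the forms), so the open sets generated by them are exactly the complements of the common zero
  loci of sets of forms.\<close>

definition zariski :: "nat \<Rightarrow> 'k::field point topology" where
  "zariski n = topology_generated_by {proj_space n - zero_locus n F | F. \<exists>d. F \<in> forms n d}"

text \<open>Morphisms between subsets \<open>U\<close> of projective \<open>n\<close>-space and \<open>V\<close> of projective \<open>m\<close>-space:
  maps given, locally for the Zariski topology on \<open>U\<close>, by \<open>m + 1\<close> forms of equal degree.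
  These forms have no common zero on \<open>W\<close>, as elements of \<open>\<phi> Q\<close> are nonzero vectors.\<close>

definition regular_map ::
    "nat \<Rightarrow> 'k::field point set \<Rightarrow> nat \<Rightarrow> 'k point set \<Rightarrow> ('k point \<Rightarrow> 'k point) \<Rightarrow> bool" where
  "regular_map n U m V \<phi> \<longleftrightarrow> \<phi> ` U \<subseteq> V \<and>
     (\<forall>P\<in>U. \<exists>W d f. openin (subtopology (zariski n) U) W \<and> P \<in> W \<and>
        (\<forall>i\<le>m. f i \<in> forms n d) \<and>
        (\<forall>Q\<in>W. \<forall>x\<in>Q. (\<lambda>i. if i \<le> m then insertion x (f i) else 0) \<in> \<phi> Q))"

definition dense_open :: "nat \<Rightarrow> 'k::field point set \<Rightarrow> 'k point set \<Rightarrow> bool" where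
  "dense_open n X U \<longleftrightarrow>
     openin (subtopology (zariski n) X) U \<and> X \<subseteq> zariski n closure_of U"

text \<open>\<open>X\<close> in projective \<open>n\<close>-space and \<open>Y\<close> in projective \<open>m\<close>-space have isomorphic dense open
  subsets.\<close>

definition birational :: "nat \<Rightarrow> 'k::field point set \<Rightarrow> nat \<Rightarrow> 'k point set \<Rightarrow> bool" where
  "birational n X m Y \<longleftrightarrow> (\<exists>U V \<phi> \<psi>.
     dense_open n X U \<and> dense_open m Y V \<and>
     regular_map n U m V \<phi> \<and> regular_map m V n U \<psi> \<and>
     (\<forall>P\<in>U. \<psi> (\<phi> P) = P) \<and> (\<forall>Q\<in>V. \<phi> (\<psi> Q) = Q))"

text \<open>A hypersurface is a scheme, given by its equation and not only by its set of points.
  Being birational to projective space, it has to be an integral scheme; over an algebraically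
  closed field and for a form \<open>F\<close> this says that \<open>F\<close> is irreducible, and the rest can then be
  expressed with \<open>k\<close>-points. As all factors of \<open>F\<close> lie in \<open>k[x\<^sub>0, \<dots>, x\<^sub>n]\<close> when \<open>F\<close> does,
  it does not matter that irreducibility is taken in the ring with infinitely many variables.\<close>

definition rational_hypersurface :: "nat \<Rightarrow> 'k::alg_closed_field mpoly \<Rightarrow> bool" where
  "rational_hypersurface n F \<longleftrightarrow>
     Factorial_Ring.irreducible F \<and> birational n (zero_locus n F) (n - 1) (proj_space (n - 1))"


section \<open>The hypersurfaces \<open>X\<^sub>s\<close>\<close>

definition E_mat :: "nat \<Rightarrow> 'k::comm_ring_1 mat" where
  "E_mat r = mat r r (\<lambda>(i, j). if i = j + 1 then 1 else 0)"

definition W_mat :: "nat \<Rightarrow> nat \<Rightarrow> 'k::comm_ring_1 mat" where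
  "W_mat n s =
     four_block_mat (1\<^sub>m s) (0\<^sub>m s (n - s + 1))
                    (0\<^sub>m (n - s + 1) s) (E_mat (n - s + 1))"

definition X_form :: "nat \<Rightarrow> nat \<Rightarrow> nat \<Rightarrow> 'k::comm_ring_1 mpoly" where
  "X_form q n s =
     (\<Sum>i\<le>n. \<Sum>j\<le>n. Const (W_mat n s $$ (i, j)) * Var i * Var j ^ q)"

end

theory Submission
  imports Defs
begin

text \<open>The equation of \<open>X\<^sub>s\<close> is linear in the last coordinate. With \<open>n = m + 1\<close> it reads
  \<open>F = x\<^sub>m\<^sup>q x\<^sub>n + G\<close>, where \<open>G\<close> is a form of degree \<open>q + 1\<close> in \<open>x\<^sub>0, \<dots>, x\<^sub>m\<close>. Hence the
  projection from the point \<open>(0 : \<dots> : 0 : 1)\<close> to projective \<open>m\<close>-space is birational on \<open>X\<^sub>s\<close>: where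
  \<open>x\<^sub>m \<noteq> 0\<close>, the last coordinate is recovered as \<open>- G / x\<^sub>m\<^sup>q\<close>, and after clearing denominators
  the inverse is given by the forms \<open>x\<^sub>m\<^sup>q x\<^sub>0, \<dots>, x\<^sub>m\<^sup>q x\<^sub>m, - G\<close> of degree \<open>q + 1\<close>.

  Irreducibility of \<open>F\<close> and density of the open set \<open>x\<^sub>m \<noteq> 0\<close> in \<open>X\<^sub>s\<close> both come from
  the fact that the prime \<open>x\<^sub>m\<close> does not divide \<open>G\<close>. By it \<open>F\<close> is primitive as a
  polynomial in \<open>x\<^sub>n\<close> of degree one (\<open>irreducible_linear\<close>), and a form that vanishes on the
  points of \<open>X\<^sub>s\<close> with \<open>x\<^sub>m \<noteq> 0\<close> is a multiple of \<open>F\<close> (\<open>linear_dvd_if_vanishes\<close>).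
  The excluded case \<open>(n, s) = (2, 0)\<close> is exactly the one where \<open>x\<^sub>m\<close> divides \<open>G\<close>: there
  \<open>G = x\<^sub>0\<^sup>q x\<^sub>1\<close> and \<open>m = 1\<close>. In all other cases some term of \<open>G\<close> does not contain
  \<open>x\<^sub>m\<close> (\<open>Var_not_dvd_X_terms\<close>).\<close>

section \<open>Evaluation of polynomials in several variables\<close>

definition monom_val :: "(nat \<Rightarrow> 'r) \<Rightarrow> (nat \<Rightarrow>\<^sub>0 nat) \<Rightarrow> 'r::comm_ring_1" where
  "monom_val x m = (\<Prod>i\<in>Poly_Mapping.keys m. x i ^ Poly_Mapping.lookup m i)"

text \<open>The values may lie in any commutative ring, with coefficients sent there by \<open>h\<close>: values in
  the field give points, values in a polynomial ring single out one variable.\<close>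

definition eval_mpoly :: "('k::comm_ring_1 \<Rightarrow> 'r) \<Rightarrow> (nat \<Rightarrow> 'r) \<Rightarrow> 'k mpoly \<Rightarrow> 'r::comm_ring_1" where
  "eval_mpoly h x F =
     (\<Sum>m\<in>Poly_Mapping.keys F. h (Poly_Mapping.lookup F m) * monom_val x m)"

lemma monom_val_superset:
  assumes "finite S" "Poly_Mapping.keys m \<subseteq> S"
  shows "monom_val x m = (\<Prod>i\<in>S. x i ^ Poly_Mapping.lookup m i)"
  unfolding monom_val_def using assms
  by (intro prod.mono_neutral_left) (auto simp: in_keys_iff)

lemma monom_val_add: "monom_val x (a + b) = monom_val x a * monom_val x b"
proof -
  let ?S = "Poly_Mapping.keys a \<union> Poly_Mapping.keys b"
  have S: "finite ?S" by simp
  show ?thesis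
    using keys_add[of a b]
    by (simp add: monom_val_superset[OF S] lookup_add power_add prod.distrib)
qed

lemma monom_val_zero [simp]: "monom_val x 0 = 1"
  by (simp add: monom_val_def)

lemma monom_val_single [simp]: "monom_val x (Poly_Mapping.single i e) = x i ^ e"
  by (simp add: monom_val_def)

lemma eval_mpoly_superset:
  assumes "comm_ring_hom h" "finite S" "Poly_Mapping.keys F \<subseteq> S"
  shows "eval_mpoly h x F = (\<Sum>m\<in>S. h (Poly_Mapping.lookup F m) * monom_val x m)"
proof -
  interpret h: comm_ring_hom h by fact
  show ?thesis
    unfolding eval_mpoly_def using assms
    by (intro sum.mono_neutral_left) (auto simp: in_keys_iff)
qed

lemma eval_mpoly_add:
  assumes "comm_ring_hom h"
  shows "eval_mpoly h x (F + G) = eval_mpoly h x F + eval_mpoly h x G"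
proof -
  interpret h: comm_ring_hom h by fact
  let ?S = "Poly_Mapping.keys F \<union> Poly_Mapping.keys G"
  have S: "finite ?S" by simp
  show ?thesis
    using keys_add[of F G]
    by (simp add: eval_mpoly_superset[OF assms S] lookup_add h.hom_add distrib_right sum.distrib)
qed

lemma eval_mpoly_single:
  assumes "comm_ring_hom h"
  shows "eval_mpoly h x (Poly_Mapping.single m c) = h c * monom_val x m"
proof -
  interpret h: comm_ring_hom h by fact
  show ?thesis by (simp add: eval_mpoly_def)
qed

lemma mpoly_sum_monomials:
  "(F :: 'k::comm_ring_1 mpoly) =
     (\<Sum>m\<in>Poly_Mapping.keys F. Poly_Mapping.single m (Poly_Mapping.lookup F m))"
  by (rule poly_mapping_eqI) (simp add: lookup_sum lookup_single when_def in_keys_iff)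

lemma eval_mpoly_sum:
  assumes "comm_ring_hom h"
  shows "eval_mpoly h x (\<Sum>i\<in>I. f i) = (\<Sum>i\<in>I. eval_mpoly h x (f i))"
proof (induction I rule: infinite_finite_induct)
  case (insert i I)
  then show ?case by (simp add: eval_mpoly_add[OF assms])
qed (simp_all add: eval_mpoly_def)

lemma eval_mpoly_mult:
  assumes "comm_ring_hom h"
  shows "eval_mpoly h x (F * G) = eval_mpoly h x F * eval_mpoly h x G"
proof -
  interpret h: comm_ring_hom h by fact
  have "F * G = (\<Sum>a\<in>Poly_Mapping.keys F. \<Sum>b\<in>Poly_Mapping.keys G.
      Poly_Mapping.single (a + b) (Poly_Mapping.lookup F a * Poly_Mapping.lookup G b))"
    by (subst (1) mpoly_sum_monomials[of F], subst (1) mpoly_sum_monomials[of G])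
       (simp only: sum_product mult_single)
  then show ?thesis
    by (simp add: eval_mpoly_sum[OF assms] eval_mpoly_single[OF assms] h.hom_mult monom_val_add
        eval_mpoly_def[of h x F] eval_mpoly_def[of h x G] sum_product mult_ac)
qed

lemma eval_mpoly_hom:
  assumes "comm_ring_hom h"
  shows "comm_ring_hom (eval_mpoly h x)"
proof -
  interpret h: comm_ring_hom h by fact
  have "eval_mpoly h x 0 = 0" "eval_mpoly h x 1 = 1"
    by (simp_all add: eval_mpoly_def)
  then show ?thesis
    by unfold_locales (simp_all add: eval_mpoly_add[OF assms] eval_mpoly_mult[OF assms])
qed

lemma eval_mpoly_Const: "comm_ring_hom h \<Longrightarrow> eval_mpoly h x (Const c) = h c"
  by (simp add: Const_def eval_mpoly_single)

lemma eval_mpoly_Var: "comm_ring_hom h \<Longrightarrow> eval_mpoly h x (Var i) = x i"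
proof -
  assume "comm_ring_hom h"
  then interpret h: comm_ring_hom h .
  show ?thesis by (simp add: Var_def eval_mpoly_single[OF h.comm_ring_hom_axioms])
qed

lemma eval_mpoly_cong:
  assumes "\<And>m i. m \<in> Poly_Mapping.keys F \<Longrightarrow> i \<in> Poly_Mapping.keys m \<Longrightarrow> x i = y i"
  shows "eval_mpoly h x F = eval_mpoly h y F"
  using assms by (simp add: eval_mpoly_def monom_val_def)

lemma comm_ring_hom_Const: "comm_ring_hom (Const :: 'k::comm_ring_1 \<Rightarrow> 'k mpoly)"
  by unfold_locales (simp_all add: Const_def single_add mult_single)

lemma comm_ring_hom_id: "comm_ring_hom (\<lambda>c::'k::comm_ring_1. c)"
  by unfold_locales simp_all

text \<open>The polynomial ring is generated by constants and variables, so its homomorphisms are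
  compared, and its elements shown to have a property, on these.\<close>

lemma mpoly_induct [case_names Const Var add mult]:
  fixes F :: "'k::comm_ring_1 mpoly"
  assumes Const: "\<And>c. P (Const c)" and Var: "\<And>i. P (Var i)"
    and add: "\<And>A B. P A \<Longrightarrow> P B \<Longrightarrow> P (A + B)" and mult: "\<And>A B. P A \<Longrightarrow> P B \<Longrightarrow> P (A * B)"
  shows "P F"
proof -
  interpret C: comm_ring_hom "Const :: 'k \<Rightarrow> 'k mpoly" by (rule comm_ring_hom_Const)
  have P01: "P 0" "P 1" using Const[of 0] Const[of 1] by simp_all
  have pow: "P A \<Longrightarrow> P (A ^ e)" for A e by (induction e) (auto intro: P01 mult)
  have prods: "(\<And>i. i \<in> I \<Longrightarrow> P (f i)) \<Longrightarrow> P (prod f I)" for f and I :: "nat set"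
    by (induction I rule: infinite_finite_induct) (auto intro: P01 mult)
  have sums: "(\<And>i. i \<in> I \<Longrightarrow> P (f i)) \<Longrightarrow> P (sum f I)" for f and I :: "(nat \<Rightarrow>\<^sub>0 nat) set"
    by (induction I rule: infinite_finite_induct) (auto intro: P01 add)
  have Var_pow: "(Var i :: 'k mpoly) ^ e = Poly_Mapping.single (Poly_Mapping.single i e) 1" for i e
    by (induction e) (simp_all add: Var_def mult_single single_add[symmetric])
  have prod_single: "(\<Prod>i\<in>I. Poly_Mapping.single (f i) (1::'k)) = Poly_Mapping.single (\<Sum>i\<in>I. f i) 1"
    for f :: "nat \<Rightarrow> (nat \<Rightarrow>\<^sub>0 nat)" and I
    by (induction I rule: infinite_finite_induct) (simp_all add: mult_single)
  have exponent: "(\<Sum>i\<in>Poly_Mapping.keys m. Poly_Mapping.single i (Poly_Mapping.lookup m i)) = m"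
    for m :: "nat \<Rightarrow>\<^sub>0 nat"
    by (rule poly_mapping_eqI) (simp add: lookup_sum lookup_single when_def in_keys_iff)
  have "P (Poly_Mapping.single m c)" for m and c :: 'k
  proof -
    have "Poly_Mapping.single m c = Const c * (\<Prod>i\<in>Poly_Mapping.keys m. Var i ^ Poly_Mapping.lookup m i)"
      by (simp add: Var_pow prod_single exponent Const_def mult_single)
    then show ?thesis by (simp add: mult Const prods pow Var)
  qed
  then show ?thesis by (subst mpoly_sum_monomials) (rule sums)
qed

lemma mpoly_hom_eqI:
  fixes f g :: "'k::comm_ring_1 mpoly \<Rightarrow> 'r::comm_ring_1"
  assumes "comm_ring_hom f" "comm_ring_hom g"
    and "\<And>c. f (Const c) = g (Const c)" "\<And>i. f (Var i) = g (Var i)"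
  shows "f F = g F"
proof -
  interpret f: comm_ring_hom f by fact
  interpret g: comm_ring_hom g by fact
  show ?thesis
    by (induction F rule: mpoly_induct) (simp_all add: assms(3,4) f.hom_add g.hom_add f.hom_mult g.hom_mult)
qed

lemma insertion_eq_eval: "insertion x F = eval_mpoly (\<lambda>c. c) x F"
  by (simp add: insertion_def eval_mpoly_def monom_val_def)

interpretation insertion: comm_ring_hom "insertion (x :: nat \<Rightarrow> 'k::comm_ring_1)" for x
  using eval_mpoly_hom[OF comm_ring_hom_id, of x] by (simp add: insertion_eq_eval[abs_def])

lemma insertion_Const [simp]: "insertion x (Const c) = c"
  by (simp add: insertion_eq_eval eval_mpoly_Const comm_ring_hom_id)

lemma insertion_Var [simp]: "insertion x (Var i) = x i"
  by (simp add: insertion_eq_eval eval_mpoly_Var comm_ring_hom_id)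

section \<open>Singling out one variable\<close>

text \<open>The isomorphism from \<open>R[x\<^sub>v]\<close> to the univariate polynomials over \<open>R\<close>, where \<open>R\<close> is
  the ring of polynomials in the other variables. It gives access to degrees and coefficients
  with respect to \<open>x\<^sub>v\<close>, and \<open>poly _ (Var v)\<close> undoes it.\<close>

definition univ :: "nat \<Rightarrow> 'k::comm_ring_1 mpoly \<Rightarrow> 'k mpoly poly" where
  "univ v = eval_mpoly (\<lambda>c. [:Const c:]) (\<lambda>i. if i = v then [:0, 1:] else [:Var i:])"

lemma comm_ring_hom_const_poly: "comm_ring_hom (\<lambda>c::'r::comm_ring_1. [:c:])"
  by unfold_locales (simp_all add: one_pCons)

lemma comm_ring_hom_compose:
  fixes f :: "'a::comm_ring_1 \<Rightarrow> 'b::comm_ring_1" and g :: "'b \<Rightarrow> 'c::comm_ring_1"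
  assumes "comm_ring_hom f" "comm_ring_hom g"
  shows "comm_ring_hom (\<lambda>c. g (f c))"
proof -
  interpret f: comm_ring_hom f by fact
  interpret g: comm_ring_hom g by fact
  show ?thesis by unfold_locales (simp_all add: f.hom_add g.hom_add f.hom_mult g.hom_mult)
qed

lemma comm_ring_hom_poly: "comm_ring_hom (\<lambda>p. poly p (a::'r::comm_ring_1))"
  by unfold_locales simp_all

lemmas comm_ring_hom_const_Const =
  comm_ring_hom_compose[OF comm_ring_hom_Const comm_ring_hom_const_poly]

interpretation univ: comm_ring_hom "univ v :: 'k::comm_ring_1 mpoly \<Rightarrow> _" for v
  unfolding univ_def by (intro eval_mpoly_hom comm_ring_hom_const_Const)

lemma univ_Const [simp]: "univ v (Const c) = [:Const c:]"
  by (simp add: univ_def eval_mpoly_Const[OF comm_ring_hom_const_Const])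

lemma univ_Var [simp]: "univ v (Var i) = (if i = v then [:0, 1:] else [:Var i:])"
  by (simp add: univ_def eval_mpoly_Var[OF comm_ring_hom_const_Const])

lemma poly_univ: "poly (univ v F) (Var v) = (F :: 'k::comm_ring_1 mpoly)"
  by (rule mpoly_hom_eqI[OF comm_ring_hom_compose[OF univ.comm_ring_hom_axioms comm_ring_hom_poly]
        comm_ring_hom_id]) simp_all

lemma univ_free:
  fixes F :: "'k::comm_ring_1 mpoly"
  assumes "\<And>m. m \<in> Poly_Mapping.keys F \<Longrightarrow> v \<notin> Poly_Mapping.keys m"
  shows "univ v F = [:F:]"
proof -
  have "univ v F = eval_mpoly (\<lambda>c. [:Const c:]) (\<lambda>i. [:Var i:]) F"
    unfolding univ_def using assms by (intro eval_mpoly_cong) auto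
  also have "\<dots> = [:F:]"
    by (rule mpoly_hom_eqI[OF eval_mpoly_hom[OF comm_ring_hom_const_Const] comm_ring_hom_const_poly])
       (simp_all add: eval_mpoly_Const[OF comm_ring_hom_const_Const]
          eval_mpoly_Var[OF comm_ring_hom_const_Const])
  finally show ?thesis .
qed

text \<open>Divisibility by \<open>x\<^sub>v\<close> is vanishing of the constant coefficient, which is multiplicative;
  this makes \<open>x\<^sub>v\<close> prime.\<close>

lemma Var_dvd_iff: "Var v dvd F \<longleftrightarrow> coeff (univ v F) 0 = (0 :: 'k::comm_ring_1 mpoly)"
proof
  assume "Var v dvd F"
  then show "coeff (univ v F) 0 = 0"
    by (auto simp: univ.hom_mult coeff_mult_0)
next
  assume "coeff (univ v F) 0 = 0"
  then obtain p where "univ v F = pCons 0 p" by (cases "univ v F") auto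
  then have "F = Var v * poly p (Var v)" using poly_univ[of v F] by simp
  then show "Var v dvd F" by (rule dvdI)
qed

lemma prime_elem_Var: "prime_elem (Var v :: 'k::idom mpoly)"
proof (rule prime_elemI)
  show "Var v \<noteq> (0 :: 'k mpoly)"
    using insertion_Var[of "\<lambda>_. 1 :: 'k" v] by force
  show "\<not> Var v dvd (1 :: 'k mpoly)" by (simp add: Var_dvd_iff)
  show "Var v dvd a \<or> Var v dvd b" if "Var v dvd (a * b :: 'k mpoly)" for a b
    using that by (simp add: Var_dvd_iff univ.hom_mult coeff_mult_0)
qed

definition free_of :: "nat \<Rightarrow> 'k::comm_ring_1 mpoly \<Rightarrow> bool" where
  "free_of v A \<longleftrightarrow> univ v A = [:A:]"

lemma insertion_fun_upd:
  "insertion (x(v := t)) A = insertion x (poly (univ v A) (Const t))"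
  by (rule mpoly_hom_eqI[OF insertion.comm_ring_hom_axioms
        comm_ring_hom_compose[OF comm_ring_hom_compose[OF univ.comm_ring_hom_axioms comm_ring_hom_poly]
          insertion.comm_ring_hom_axioms]]) simp_all

lemma insertion_free_of: "free_of v A \<Longrightarrow> insertion (x(v := t)) A = insertion x A"
  by (simp add: insertion_fun_upd free_of_def)

lemma free_of_add: "free_of v A \<Longrightarrow> free_of v B \<Longrightarrow> free_of v (A + B)"
  by (simp add: free_of_def univ.hom_add)

lemma free_of_mult: "free_of v A \<Longrightarrow> free_of v B \<Longrightarrow> free_of v (A * B)"
  by (simp add: free_of_def univ.hom_mult)

lemma free_of_one: "free_of v 1"
  by (simp add: free_of_def univ.hom_one one_pCons)

lemma free_of_power: "free_of v A \<Longrightarrow> free_of v (A ^ e)"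
  by (induction e) (auto intro: free_of_mult free_of_one)

lemma free_of_uminus: "free_of v A \<Longrightarrow> free_of v (- A)"
  by (simp add: free_of_def univ.hom_uminus)

section \<open>Polynomials vanishing at all points\<close>

lemma infinite_UNIV_alg_closed_field: "infinite (UNIV :: 'k::alg_closed_field set)"
proof
  assume fin: "finite (UNIV :: 'k set)"
  define p :: "'k poly" where "p = (\<Prod>a\<in>UNIV. [:- a, 1:])"
  have "degree p = card (UNIV :: 'k set)"
    unfolding p_def by (subst degree_prod_eq_sum_degree) auto
  then have pos: "degree p > 0" using fin by (simp add: finite_UNIV_card_ge_0)
  then have "degree (p + 1) > 0" by (simp add: degree_add_eq_left)
  then obtain x where "poly (p + 1) x = 0" using alg_closed_imp_poly_has_root by blast
  moreover have "poly p x = 0"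
    unfolding p_def poly_prod using fin by (intro prod_zero) auto
  ultimately show False by simp
qed

text \<open>Values are substituted for one variable at a time. As long as the polynomial is nonzero,
  it has finitely many roots as a polynomial in the next variable, so that some constant is
  no root.\<close>

lemma exists_insertion_nonzero:
  fixes F :: "'k::idom mpoly"
  assumes inf: "infinite (UNIV :: 'k set)" and "F \<noteq> 0"
  shows "\<exists>x. insertion x F \<noteq> 0"
proof -
  define spec :: "nat set \<Rightarrow> (nat \<Rightarrow> 'k) \<Rightarrow> 'k mpoly \<Rightarrow> 'k mpoly"
    where "spec S x = eval_mpoly Const (\<lambda>i. if i \<in> S then Const (x i) else Var i)" for S x
  note CC = comm_ring_hom_Const[where 'k = 'k]
  have spec: "comm_ring_hom (spec S x)" "spec S x (Const c) = Const c"
    "spec S x (Var i) = (if i \<in> S then Const (x i) else Var i)" for S x c i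
    by (simp_all add: spec_def eval_mpoly_hom[OF CC] eval_mpoly_Const[OF CC] eval_mpoly_Var[OF CC])
  have "\<exists>x. spec S x F \<noteq> 0" if "finite S" for S
    using that
  proof (induction S rule: finite_induct)
    case empty
    have "spec {} x F = F" for x
      by (rule mpoly_hom_eqI[OF spec(1) comm_ring_hom_id]) (simp_all add: spec)
    then show ?case using \<open>F \<noteq> 0\<close> by simp
  next
    case (insert v S)
    then obtain x where x: "spec S x F \<noteq> 0" by blast
    have "univ v (spec S x F) \<noteq> 0"
    proof
      assume "univ v (spec S x F) = 0"
      then show False using poly_univ[of v "spec S x F"] x by simp
    qed
    then have "finite {a. poly (univ v (spec S x F)) a = 0}" by (rule poly_roots_finite)
    moreover have "infinite (range (Const :: 'k \<Rightarrow> 'k mpoly))"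
      using inf by (simp add: Const_def[abs_def] finite_image_iff)
    ultimately obtain c where c: "poly (univ v (spec S x F)) (Const c) \<noteq> 0"
      using finite_subset[of "range Const" "{a. poly (univ v (spec S x F)) a = 0}"] by blast
    have "poly (univ v (spec S x F)) (Const c) = spec (insert v S) (x(v := c)) F"
      by (rule mpoly_hom_eqI[OF comm_ring_hom_compose[OF spec(1)
              comm_ring_hom_compose[OF univ.comm_ring_hom_axioms comm_ring_hom_poly]] spec(1)])
         (use insert.hyps(2) in \<open>auto simp: spec\<close>)
    then show ?case using c by metis
  qed
  moreover define S where "S = (\<Union>m\<in>Poly_Mapping.keys F. Poly_Mapping.keys m)"
  ultimately obtain x where "spec S x F \<noteq> 0" by fastforce
  moreover have "spec S x F = eval_mpoly Const (\<lambda>i. Const (x i)) F"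
    unfolding spec_def by (rule eval_mpoly_cong) (auto simp: S_def)
  moreover have "eval_mpoly Const (\<lambda>i. Const (x i)) F = Const (insertion x F)"
    by (rule mpoly_hom_eqI[OF eval_mpoly_hom[OF CC]
          comm_ring_hom_compose[OF insertion.comm_ring_hom_axioms CC]])
       (simp_all add: eval_mpoly_Const[OF CC] eval_mpoly_Var[OF CC])
  ultimately have "Const (insertion x F) \<noteq> 0" by metis
  then have "insertion x F \<noteq> 0" by (auto simp: Const_def)
  then show ?thesis by blast
qed

section \<open>Polynomials linear in one variable\<close>

lemma prime_elem_power_dvd_cancel:
  fixes r :: "'a::idom"
  assumes r: "prime_elem r" "\<not> r dvd b" and "r ^ N dvd b * c"
  shows "r ^ N dvd c"
  using assms(3)
proof (induction N arbitrary: c)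
  case (Suc N)
  have "r dvd b * c" using Suc.prems by (metis dvd_mult_left power_Suc)
  with r obtain d where d: "c = r * d" by (auto simp: prime_elem_dvd_mult_iff)
  have "r * r ^ N dvd r * (b * d)" using Suc.prems by (simp add: d mult_ac)
  then have "r ^ N dvd b * d" using r by (auto simp: prime_elem_def)
  then have "r ^ N dvd d" by (rule Suc.IH)
  then show ?case unfolding d power_Suc by (rule mult_dvd_mono[OF dvd_refl])
qed simp

text \<open>If \<open>F = r\<^sup>q x\<^sub>v + G\<close> is a product, one factor has degree \<open>0\<close> in \<open>x\<^sub>v\<close>, so it divides
  both coefficients \<open>r\<^sup>q\<close> and \<open>G\<close>. As \<open>r\<close> does not divide \<open>G\<close>, it does not divide this factor; and
  a divisor of a power of the prime \<open>r\<close> that is not divisible by \<open>r\<close> is a unit.\<close>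

lemma irreducible_linear:
  fixes r G :: "'k::idom mpoly"
  assumes r: "prime_elem r" "\<not> r dvd G" and free: "free_of v r" "free_of v G"
  shows "irreducible (r ^ q * Var v + G)"
proof -
  let ?F = "r ^ q * Var v + G"
  have F: "univ v ?F = [:G, r ^ q:]"
    using free free_of_power[OF free(1), of q]
    by (simp add: free_of_def univ.hom_add univ.hom_mult)
  have rq: "r ^ q \<noteq> 0" using r by (auto simp: prime_elem_def)
  have deg: "degree (univ v ?F) = 1" using rq by (simp add: F)
  have unit: "b dvd 1" if "?F = a * b" "degree (univ v b) = 0" for a b
  proof -
    from that(2) obtain b' where b': "univ v b = [:b':]" using degree_eq_zeroE by blast
    then have b: "b = b'" using poly_univ[of v b] by simp
    have *: "[:G, r ^ q:] = univ v a * [:b:]" using that(1) F b b' by (metis univ.hom_mult)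
    have "G = coeff (univ v a) 0 * b" "r ^ q = coeff (univ v a) 1 * b"
      using arg_cong[OF *, of "\<lambda>p. coeff p 0"] arg_cong[OF *, of "\<lambda>p. coeff p 1"]
      by (simp_all add: mult.commute)
    then obtain c where c: "b dvd G" "r ^ q = b * c" by (metis dvd_triv_right mult.commute)
    then have "\<not> r dvd b" using r by (metis dvd_trans)
    then have "r ^ q dvd c"
      using prime_elem_power_dvd_cancel[OF r(1), of b q c] c(2) by simp
    then obtain d where "c = r ^ q * d" by (rule dvdE)
    then have "r ^ q * (b * d) = r ^ q * 1" using c(2) by (simp add: mult_ac)
    then have "b * d = 1" using rq mult_left_cancel by blast
    then show ?thesis by (metis dvd_triv_left)
  qed
  show ?thesis
  proof (rule irreducibleI)
    show "?F \<noteq> 0" using deg by auto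
    show "\<not> ?F dvd 1"
    proof
      assume "?F dvd 1"
      then obtain c where "1 = ?F * c" by blast
      then have *: "univ v ?F * univ v c = 1" by (metis univ.hom_mult univ.hom_one)
      then have nz: "univ v ?F \<noteq> 0" "univ v c \<noteq> 0" by auto
      have "degree (univ v ?F * univ v c) = 1 + degree (univ v c)"
        using degree_mult_eq[OF nz] deg by linarith
      then show False using * by simp
    qed
    fix a b assume ab: "?F = a * b"
    then have *: "univ v ?F = univ v a * univ v b" by (simp only: univ.hom_mult)
    then have nz: "univ v a \<noteq> 0" "univ v b \<noteq> 0" using deg by auto
    have "degree (univ v a) + degree (univ v b) = 1"
      using degree_mult_eq[OF nz] deg * by metis
    then have "degree (univ v a) = 0 \<or> degree (univ v b) = 0" by linarith
    then show "a dvd 1 \<or> b dvd 1"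
      using unit[of a b] unit[of b a] ab by (metis mult.commute)
  qed
qed

text \<open>Modulo \<open>a x\<^sub>v + G\<close> one may replace \<open>a x\<^sub>v\<close> by \<open>- G\<close>, so a sufficiently high power of
  \<open>a\<close> removes \<open>x\<^sub>v\<close> altogether. The set of \<open>A\<close> for which this succeeds is a subring containing
  the constants and the variables.\<close>

lemma pseudo_division_linear:
  fixes A :: "'k::comm_ring_1 mpoly"
  assumes free: "free_of v a" "free_of v G"
  shows "\<exists>N Q R. a ^ N * A = (a * Var v + G) * Q + R \<and> free_of v R"
proof (induction A rule: mpoly_induct)
  case (Const c)
  have "a ^ 0 * Const c = (a * Var v + G) * 0 + Const c \<and> free_of v (Const c)"
    by (simp add: free_of_def)
  then show ?case by blast
next
  case (Var i)
  show ?case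
  proof (cases "i = v")
    case True
    have "a ^ 1 * Var i = (a * Var v + G) * 1 + (- G) \<and> free_of v (- G)"
      using True free by (simp add: free_of_uminus)
    then show ?thesis by blast
  next
    case False
    have "a ^ 0 * Var i = (a * Var v + G) * 0 + Var i \<and> free_of v (Var i)"
      using False by (simp add: free_of_def)
    then show ?thesis by blast
  qed
next
  case (add A B)
  then obtain N Q R N' Q' R' where
    A: "a ^ N * A = (a * Var v + G) * Q + R" "free_of v R" and
    B: "a ^ N' * B = (a * Var v + G) * Q' + R'" "free_of v R'" by blast
  have "a ^ (N + N') * (A + B) = a ^ N' * (a ^ N * A) + a ^ N * (a ^ N' * B)"
    by (simp add: power_add algebra_simps)
  also have "\<dots> = (a * Var v + G) * (a ^ N' * Q + a ^ N * Q') + (a ^ N' * R + a ^ N * R')"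
    unfolding A B by (simp add: algebra_simps)
  finally show ?case
    using A B free by (blast intro: free_of_add free_of_mult free_of_power)
next
  case (mult A B)
  then obtain N Q R N' Q' R' where
    A: "a ^ N * A = (a * Var v + G) * Q + R" "free_of v R" and
    B: "a ^ N' * B = (a * Var v + G) * Q' + R'" "free_of v R'" by blast
  have "a ^ (N + N') * (A * B) = (a ^ N * A) * (a ^ N' * B)"
    by (simp add: power_add mult_ac)
  also have "\<dots> = (a * Var v + G) * (Q * ((a * Var v + G) * Q' + R') + R * Q') + R * R'"
    unfolding A B by (simp add: algebra_simps)
  finally show ?case
    using A B by (blast intro: free_of_mult)
qed

text \<open>This is the Nullstellensatz for \<open>F = r\<^sup>q x\<^sub>v + G\<close>, over any infinite field. Where \<open>r\<close> does
  not vanish, the equation \<open>F = 0\<close> can be solved for \<open>x\<^sub>v\<close>. So the remainder \<open>R\<close> of a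
  pseudo-division of \<open>A\<close> by \<open>F\<close>, which does not depend on \<open>x\<^sub>v\<close>, vanishes wherever \<open>r\<close> does
  not, and is \<open>0\<close>. Hence \<open>F\<close> divides a power of \<open>r\<close> times \<open>A\<close>, and this power can be
  cancelled because \<open>r\<close> does not divide \<open>F\<close>.\<close>

lemma linear_dvd_if_vanishes:
  fixes r G A :: "'k::field mpoly"
  assumes inf: "infinite (UNIV :: 'k set)"
    and r: "prime_elem r" "\<not> r dvd G" and free: "free_of v r" "free_of v G" and "q > 0"
    and van: "\<And>x. insertion x r \<noteq> 0 \<Longrightarrow> insertion x (r ^ q * Var v + G) = 0 \<Longrightarrow> insertion x A = 0"
  shows "(r ^ q * Var v + G) dvd A"
proof -
  let ?F = "r ^ q * Var v + G"
  obtain N Q R where div: "(r ^ q) ^ N * A = ?F * Q + R" and R: "free_of v R"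
    using pseudo_division_linear[OF free_of_power[OF free(1)] free(2)] by blast
  have "insertion x (r * R) = 0" for x
  proof (cases "insertion x r = 0")
    case False
    define x' where "x' = x(v := - insertion x G / insertion x r ^ q)"
    have inv: "insertion x' B = insertion x B" if "free_of v B" for B
      using that by (simp add: x'_def insertion_free_of)
    have F0: "insertion x' ?F = 0"
      using False by (simp add: insertion.hom_add insertion.hom_mult insertion.hom_power
          inv[OF free(1)] inv[OF free(2)]) (simp add: x'_def)
    then have "insertion x' A = 0" using van False inv[OF free(1)] by simp
    then have "insertion x' ((r ^ q) ^ N * A) = 0" by (simp add: insertion.hom_mult)
    then have "insertion x' (?F * Q) + insertion x' R = 0"
      unfolding div by (simp only: insertion.hom_add)
    then have "insertion x' R = 0" using F0 by (simp only: insertion.hom_mult) simp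
    then show ?thesis using inv[OF R] by (simp add: insertion.hom_mult)
  qed (simp add: insertion.hom_mult)
  then have "r * R = 0" using exists_insertion_nonzero[OF inf] by blast
  then have "R = 0" using r by (auto simp: prime_elem_def)
  then have eq: "r ^ (q * N) * A = ?F * Q" using div by (simp add: power_mult)
  have "\<not> r dvd ?F"
    using r(2) \<open>q > 0\<close> by (subst dvd_add_right_iff) (auto intro: dvd_mult2 dvd_power)
  then obtain D where "Q = r ^ (q * N) * D"
    using prime_elem_power_dvd_cancel[OF r(1), of ?F "q * N" Q] eq by (metis dvd_triv_left dvd_def)
  then have "r ^ (q * N) * A = r ^ (q * N) * (?F * D)" using eq by (simp add: mult_ac)
  then have "A = ?F * D" using r(1) by (auto simp: prime_elem_def)
  then show ?thesis by (metis dvd_triv_left)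
qed

section \<open>Forms\<close>

lemma forms_iff:
  "F \<in> forms n d \<longleftrightarrow> (\<forall>m\<in>Poly_Mapping.keys F. Poly_Mapping.keys m \<subseteq> {..n} \<and>
     (\<Sum>i\<le>n. Poly_Mapping.lookup m i) = d)"
proof -
  have "(\<Sum>i\<in>Poly_Mapping.keys m. Poly_Mapping.lookup m i) = (\<Sum>i\<le>n. Poly_Mapping.lookup m i)"
    if "Poly_Mapping.keys m \<subseteq> {..n}" for m :: "nat \<Rightarrow>\<^sub>0 nat"
    using that by (intro sum.mono_neutral_left) (auto simp: in_keys_iff)
  then show ?thesis unfolding forms_def by auto
qed

lemma forms_add: "A \<in> forms n d \<Longrightarrow> B \<in> forms n d \<Longrightarrow> A + B \<in> forms n d"
  using keys_add[of A B] unfolding forms_iff by blast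

lemma forms_zero: "0 \<in> forms n d"
  by (simp add: forms_def)

lemma forms_sum: "(\<And>i. i \<in> I \<Longrightarrow> f i \<in> forms n d) \<Longrightarrow> (\<Sum>i\<in>I. f i) \<in> forms n d"
  by (induction I rule: infinite_finite_induct) (auto intro: forms_add forms_zero)

lemma forms_uminus: "A \<in> forms n d \<Longrightarrow> - A \<in> forms n d"
proof -
  have "Poly_Mapping.keys (- A) = Poly_Mapping.keys A" by (auto simp: in_keys_iff)
  then show "A \<in> forms n d \<Longrightarrow> - A \<in> forms n d" by (simp add: forms_def)
qed

lemma forms_mult:
  assumes "A \<in> forms n d" "B \<in> forms n e"
  shows "A * B \<in> forms n (d + e)"
  unfolding forms_iff
proof
  fix m assume "m \<in> Poly_Mapping.keys (A * B)"
  then obtain a b where m: "m = a + b" "a \<in> Poly_Mapping.keys A" "b \<in> Poly_Mapping.keys B"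
    using keys_mult[of A B] by blast
  then show "Poly_Mapping.keys m \<subseteq> {..n} \<and> (\<Sum>i\<le>n. Poly_Mapping.lookup m i) = d + e"
    using assms keys_add[of a b] by (fastforce simp: forms_iff lookup_add sum.distrib)
qed

lemma forms_one: "1 \<in> forms n 0"
  by (simp add: forms_def)

lemma forms_Var: "i \<le> n \<Longrightarrow> Var i \<in> forms n (Suc 0)"
  by (simp add: forms_def Var_def)

lemma forms_Var_power: "i \<le> n \<Longrightarrow> Var i ^ e \<in> forms n e"
  using forms_mult[OF forms_Var] by (induction e) (auto intro: forms_one)

lemma forms_mono: "n \<le> n' \<Longrightarrow> forms n d \<subseteq> forms n' d"
  by (fastforce simp: forms_def)

lemma free_of_forms: "G \<in> forms n d \<Longrightarrow> n < v \<Longrightarrow> free_of v G"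
  unfolding free_of_def forms_def by (intro univ_free) fastforce

lemma insertion_forms_cong:
  assumes "F \<in> forms n d" "\<And>i. i \<le> n \<Longrightarrow> x i = y i"
  shows "insertion x F = insertion y F"
  unfolding insertion_eq_eval using assms by (intro eval_mpoly_cong) (auto simp: forms_def)

lemma insertion_forms_scale:
  assumes "F \<in> forms n d"
  shows "insertion (\<lambda>i. c * x i) F = c ^ d * insertion x F"
proof -
  have "(\<Prod>i\<in>Poly_Mapping.keys m. (c * x i) ^ Poly_Mapping.lookup m i) =
      c ^ d * (\<Prod>i\<in>Poly_Mapping.keys m. x i ^ Poly_Mapping.lookup m i)"
    if "m \<in> Poly_Mapping.keys F" for m
    using assms that by (auto simp: forms_def power_mult_distrib prod.distrib power_sum)
  then show ?thesis
    by (simp add: insertion_def sum_distrib_left mult_ac)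
qed

section \<open>Points and open sets of projective space\<close>

definition pt :: "nat \<Rightarrow> (nat \<Rightarrow> 'k::field) \<Rightarrow> 'k point" where
  "pt n x = proportional n `` {x}"

lemma hcoords_scale: "x \<in> hcoords n \<Longrightarrow> c \<noteq> 0 \<Longrightarrow> (\<lambda>i. c * x i) \<in> hcoords n"
  by (auto simp: hcoords_def)

lemma pt_eq: "x \<in> hcoords n \<Longrightarrow> pt n x = {\<lambda>i. c * x i | c. c \<noteq> 0}"
  by (auto simp: pt_def proportional_def hcoords_scale)

lemma proj_space_eq: "proj_space n = pt n ` hcoords n"
  by (auto simp: proj_space_def quotient_def pt_def)

lemma pt_scale:
  assumes "x \<in> hcoords n" "c \<noteq> 0"
  shows "pt n (\<lambda>i. c * x i) = pt n x"
proof -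
  have "\<exists>c'. (\<lambda>i. d * x i) = (\<lambda>i. c' * (c * x i)) \<and> c' \<noteq> 0" if "d \<noteq> 0" for d
    using assms(2) that by (intro exI[of _ "d / c"]) auto
  moreover have "\<exists>c'. (\<lambda>i. d * (c * x i)) = (\<lambda>i. c' * x i) \<and> c' \<noteq> 0" if "d \<noteq> 0" for d
    using assms(2) that by (intro exI[of _ "d * c"]) (auto simp: mult_ac)
  ultimately show ?thesis
    unfolding pt_eq[OF assms(1)] pt_eq[OF hcoords_scale[OF assms]] by blast
qed

definition nonzero_locus :: "nat \<Rightarrow> 'k::field mpoly \<Rightarrow> 'k point set" where
  "nonzero_locus n F = proj_space n - zero_locus n F"

lemma pt_in_zero_locus:
  assumes "F \<in> forms n d" "x \<in> hcoords n"
  shows "pt n x \<in> zero_locus n F \<longleftrightarrow> insertion x F = 0"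
proof -
  have "x \<in> pt n x" unfolding pt_eq[OF assms(2)] by (auto intro!: exI[of _ 1])
  then show ?thesis
    using assms by (auto simp: zero_locus_def proj_space_eq pt_eq insertion_forms_scale)
qed

lemma pt_in_nonzero_locus:
  "F \<in> forms n d \<Longrightarrow> x \<in> hcoords n \<Longrightarrow> pt n x \<in> nonzero_locus n F \<longleftrightarrow> insertion x F \<noteq> 0"
  by (simp add: nonzero_locus_def pt_in_zero_locus proj_space_eq)

lemma nonzero_locus_mult:
  fixes A B :: "'k::field mpoly"
  assumes "A \<in> forms n d" "B \<in> forms n e"
  shows "nonzero_locus n (A * B) = nonzero_locus n A \<inter> nonzero_locus n B"
proof -
  have "pt n x \<in> nonzero_locus n (A * B) \<longleftrightarrow> pt n x \<in> nonzero_locus n A \<inter> nonzero_locus n B"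
    if "x \<in> hcoords n" for x :: "nat \<Rightarrow> 'k"
    using that assms by (simp add: pt_in_nonzero_locus forms_mult[OF assms] insertion.hom_mult
        pt_in_nonzero_locus[OF forms_mult[OF assms]])
  then show ?thesis by (fastforce simp: nonzero_locus_def proj_space_eq)
qed

lemma openin_nonzero_locus: "F \<in> forms n d \<Longrightarrow> openin (zariski n) (nonzero_locus n F)"
  unfolding zariski_def nonzero_locus_def by (intro topology_generated_by_Basis) blast

lemma topspace_zariski: "topspace (zariski n) = proj_space n"
proof -
  have "nonzero_locus n (1 :: 'a mpoly) = proj_space n"
    using pt_in_nonzero_locus[OF forms_one, of _ n, where ?'a = 'a]
    by (auto simp: nonzero_locus_def proj_space_eq insertion.hom_one)
  then have "proj_space n \<subseteq> topspace (zariski n :: 'a point topology)"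
    by (metis openin_nonzero_locus[OF forms_one] openin_subset)
  then show ?thesis by (auto simp: zariski_def)
qed

text \<open>A finite intersection of nonzero loci is the nonzero locus of the product, so these sets
  form a basis and not only a subbasis.\<close>

lemma zariski_basis:
  assumes "openin (zariski n) T" "P \<in> T"
  shows "\<exists>H d. H \<in> forms n d \<and> P \<in> nonzero_locus n H \<and> nonzero_locus n H \<subseteq> T"
proof -
  have "generate_topology_on {proj_space n - zero_locus n F | F. \<exists>d. F \<in> forms n d} T"
    using assms(1) unfolding zariski_def by (rule openin_topology_generated_by)
  then show ?thesis using assms(2)
  proof (induction arbitrary: P)
    case (Int A B)
    obtain H d where H: "H \<in> forms n d" "P \<in> nonzero_locus n H" "nonzero_locus n H \<subseteq> A"
      using Int.IH(1)[of P] Int.prems by blast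
    obtain K e where K: "K \<in> forms n e" "P \<in> nonzero_locus n K" "nonzero_locus n K \<subseteq> B"
      using Int.IH(2)[of P] Int.prems by blast
    show ?case
      using H K forms_mult[OF H(1) K(1)] nonzero_locus_mult[OF H(1) K(1)] by blast
  next
    case (UN K)
    from UN.prems obtain S where S: "S \<in> K" "P \<in> S" by blast
    then obtain H d where "H \<in> forms n d" "P \<in> nonzero_locus n H" "nonzero_locus n H \<subseteq> S"
      using UN.IH[of S P] by blast
    then show ?case using S by blast
  next
    case (Basis S)
    then show ?case unfolding nonzero_locus_def by blast
  qed simp
qed

text \<open>Density of the part of \<open>X\<close> where a form \<open>H\<close> does not vanish thus says that a form that
  vanishes on this part vanishes on \<open>X\<close>.\<close>

lemma dense_open_nonzero_locus:
  assumes "X \<subseteq> proj_space n" "H \<in> forms n d"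
    and van: "\<And>A e. A \<in> forms n e \<Longrightarrow> X \<inter> nonzero_locus n H \<subseteq> zero_locus n A \<Longrightarrow> X \<subseteq> zero_locus n A"
  shows "dense_open n X (X \<inter> nonzero_locus n H)"
  unfolding dense_open_def
proof
  show "openin (subtopology (zariski n) X) (X \<inter> nonzero_locus n H)"
    using openin_nonzero_locus[OF assms(2)] by (auto simp: openin_subtopology)
  show "X \<subseteq> zariski n closure_of (X \<inter> nonzero_locus n H)"
  proof
    fix P assume P: "P \<in> X"
    have "\<exists>Q. Q \<in> X \<inter> nonzero_locus n H \<and> Q \<in> T" if "P \<in> T" "openin (zariski n) T" for T
    proof -
      from zariski_basis[OF that(2,1)]
      obtain A e where A: "A \<in> forms n e" "P \<in> nonzero_locus n A" "nonzero_locus n A \<subseteq> T"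
        by blast
      then have "\<not> X \<subseteq> zero_locus n A" using P by (auto simp: nonzero_locus_def)
      then obtain Q where "Q \<in> X \<inter> nonzero_locus n H" "Q \<notin> zero_locus n A"
        using van[OF A(1)] by blast
      then show ?thesis using A(3) assms(1) by (auto simp: nonzero_locus_def)
    qed
    then show "P \<in> zariski n closure_of (X \<inter> nonzero_locus n H)"
      using P assms(1) by (auto simp: in_closure_of topspace_zariski)
  qed
qed

text \<open>Forms in \<open>x\<^sub>0, \<dots>, x\<^sub>n\<close> can be evaluated at arbitrary sequences, but coordinate vectors must
  be \<open>0\<close> beyond \<open>n\<close>. Truncation passes between the two, and in coordinates it is also the
  projection from \<open>(0 : \<dots> : 0 : 1)\<close>.\<close>

definition trunc :: "nat \<Rightarrow> (nat \<Rightarrow> 'k::zero) \<Rightarrow> nat \<Rightarrow> 'k" where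
  "trunc n x = (\<lambda>i. if i \<le> n then x i else 0)"

lemma trunc_hcoords: "i \<le> n \<Longrightarrow> x i \<noteq> 0 \<Longrightarrow> trunc n x \<in> hcoords n"
  by (auto simp: hcoords_def trunc_def)

lemma insertion_trunc: "F \<in> forms n d \<Longrightarrow> insertion (trunc n x) F = insertion x F"
  by (erule insertion_forms_cong) (simp add: trunc_def)

section \<open>Maps given by forms\<close>

text \<open>The set is formed from all representatives \<open>x\<close> of \<open>P\<close> and all scalars \<open>c\<close>, which
  avoids the choice of a representative.\<close>

definition form_map :: "nat \<Rightarrow> (nat \<Rightarrow> 'k::field mpoly) \<Rightarrow> 'k point \<Rightarrow> 'k point" where
  "form_map m f P = {\<lambda>j. c * trunc m (\<lambda>i. insertion x (f i)) j | c x. c \<noteq> 0 \<and> x \<in> P}"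

lemma form_map_pt:
  assumes f: "\<And>i. i \<le> m \<Longrightarrow> f i \<in> forms n d" and x: "x \<in> hcoords n"
    and y: "trunc m (\<lambda>i. insertion x (f i)) \<in> hcoords m"
  shows "form_map m f (pt n x) = pt m (trunc m (\<lambda>i. insertion x (f i)))"
proof -
  let ?y = "trunc m (\<lambda>i. insertion x (f i))"
  have *: "(\<lambda>j. c * trunc m (\<lambda>i. insertion (\<lambda>k. b * x k) (f i)) j) = (\<lambda>j. (c * b ^ d) * ?y j)" for b c
    by (rule ext) (simp add: trunc_def insertion_forms_scale[OF f])
  have "form_map m f (pt n x) = {\<lambda>j. (c * b ^ d) * ?y j | c b. c \<noteq> 0 \<and> b \<noteq> 0}" (is "_ = ?R")
    unfolding form_map_def pt_eq[OF x] *[symmetric] by blast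
  also have "\<dots> = {\<lambda>j. c * ?y j | c. c \<noteq> 0}" (is "_ = ?S")
  proof
    show "?R \<subseteq> ?S"
    proof
      fix z assume "z \<in> ?R"
      then obtain c b where "c * b ^ d \<noteq> 0" "z = (\<lambda>j. (c * b ^ d) * ?y j)" by auto
      then show "z \<in> ?S" by blast
    qed
    show "?S \<subseteq> ?R"
    proof
      fix z assume "z \<in> ?S"
      then obtain c where "c \<noteq> 0" "z = (\<lambda>j. c * ?y j)" by auto
      then show "z \<in> ?R" by (intro CollectI exI[of _ c] exI[of _ 1]) simp
    qed
  qed
  finally show ?thesis by (simp add: pt_eq[OF y])
qed

lemma regular_map_form_map:
  assumes U: "U \<subseteq> proj_space n" and f: "\<And>i. i \<le> m \<Longrightarrow> f i \<in> forms n d"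
    and V: "\<And>P. P \<in> U \<Longrightarrow> form_map m f P \<in> V"
  shows "regular_map n U m V (form_map m f)"
  unfolding regular_map_def
proof (intro conjI ballI)
  show "form_map m f ` U \<subseteq> V" using V by blast
  fix P assume P: "P \<in> U"
  have "openin (subtopology (zariski n) U) U"
    using U by (simp add: openin_subtopology_refl topspace_zariski)
  moreover have "(\<lambda>i. if i \<le> m then insertion x (f i) else 0) \<in> form_map m f Q" if "x \<in> Q" for x Q
    unfolding form_map_def trunc_def mem_Collect_eq using that
    by (intro exI[of _ 1] exI[of _ x]) simp
  ultimately show "\<exists>W d g. openin (subtopology (zariski n) U) W \<and> P \<in> W \<and>
      (\<forall>i\<le>m. g i \<in> forms n d) \<and>
      (\<forall>Q\<in>W. \<forall>x\<in>Q. (\<lambda>i. if i \<le> m then insertion x (g i) else 0) \<in> form_map m f Q)"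
    using P f by blast
qed

section \<open>Hypersurfaces with an equation linear in the last coordinate\<close>

text \<open>The projection is \<open>form_map m f\<close> and its inverse is \<open>form_map (Suc m) g\<close>. On coordinate
  vectors, the two composites multiply by \<open>x\<^sub>m\<^sup>q\<close>, so they are the identity on points
  with \<open>x\<^sub>m \<noteq> 0\<close>.\<close>

lemma rational_hypersurface_linear:
  fixes G :: "'k::alg_closed_field mpoly"
  assumes G: "G \<in> forms m (Suc q)" "\<not> Var m dvd G" and "q > 0"
  shows "rational_hypersurface (Suc m) (Var m ^ q * Var (Suc m) + G)"
proof -
  define F where "F = Var m ^ q * Var (Suc m) + G"
  note inf = infinite_UNIV_alg_closed_field[where 'k = 'k]
  have prime: "prime_elem (Var m :: 'k mpoly)" by (rule prime_elem_Var)
  have free: "free_of (Suc m) (Var m :: 'k mpoly)" "free_of (Suc m) G"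
    using G(1) by (auto simp: free_of_def[of _ "Var m"] intro: free_of_forms)
  have irred: "irreducible F"
    unfolding F_def by (rule irreducible_linear[OF prime G(2) free])

  have G': "G \<in> forms (Suc m) (Suc q)" using G(1) forms_mono[of m "Suc m"] by auto
  have F: "F \<in> forms (Suc m) (Suc q)"
    unfolding F_def using forms_mult[OF forms_Var_power[of m "Suc m" q] forms_Var[of "Suc m" "Suc m"]] G'
    by (auto intro: forms_add)
  have insF: "insertion x F = x m ^ q * x (Suc m) + insertion x G" for x
    by (simp add: F_def insertion.hom_add insertion.hom_mult insertion.hom_power)
  have Var_m: "(Var m :: 'k mpoly) \<in> forms m (Suc 0)" "(Var m :: 'k mpoly) \<in> forms (Suc m) (Suc 0)"
    by (simp_all add: forms_Var)

  define X where "X = zero_locus (Suc m) F"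
  define U where "U = X \<inter> nonzero_locus (Suc m) (Var m)"
  define V where "V = proj_space m \<inter> nonzero_locus m (Var m :: 'k mpoly)"
  have X_sub: "X \<subseteq> proj_space (Suc m)" by (auto simp: X_def zero_locus_def)
  have pt_U: "pt (Suc m) x \<in> U \<longleftrightarrow> x m \<noteq> 0 \<and> insertion x F = 0" if "x \<in> hcoords (Suc m)" for x
    using that by (auto simp: U_def X_def pt_in_zero_locus[OF F] pt_in_nonzero_locus[OF Var_m(2)])
  have pt_V: "pt m y \<in> V \<longleftrightarrow> y m \<noteq> 0" if "y \<in> hcoords m" for y :: "nat \<Rightarrow> 'k"
    using that by (simp add: V_def proj_space_eq pt_in_nonzero_locus[OF Var_m(1)])

  have dense_U: "dense_open (Suc m) X U"
    unfolding U_def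
  proof (rule dense_open_nonzero_locus[OF X_sub Var_m(2)])
    fix A e assume A: "A \<in> forms (Suc m) e" "X \<inter> nonzero_locus (Suc m) (Var m) \<subseteq> zero_locus (Suc m) A"
    have "insertion x A = 0" if "x m \<noteq> 0" "insertion x F = 0" for x
    proof -
      have h: "trunc (Suc m) x \<in> hcoords (Suc m)" using that(1) by (rule trunc_hcoords[rotated]) simp
      have "pt (Suc m) (trunc (Suc m) x) \<in> U"
        using that by (simp add: pt_U[OF h] insertion_trunc[OF F]) (simp add: trunc_def)
      then have "insertion (trunc (Suc m) x) A = 0"
        using A(2) pt_in_zero_locus[OF A(1) h] by (auto simp: U_def)
      then show ?thesis by (simp add: insertion_trunc[OF A(1)])
    qed
    then have "F dvd A"
      unfolding F_def by (intro linear_dvd_if_vanishes[OF inf prime G(2) free \<open>q > 0\<close>]) simp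
    then obtain B where B: "A = F * B" by blast
    show "X \<subseteq> zero_locus (Suc m) A"
    proof
      fix P assume "P \<in> X"
      then show "P \<in> zero_locus (Suc m) A"
        by (simp add: X_def zero_locus_def B insertion.hom_mult)
    qed
  qed

  have dense_V: "dense_open m (proj_space m) V"
    unfolding V_def
  proof (rule dense_open_nonzero_locus[OF subset_refl Var_m(1)])
    fix A :: "'k mpoly" and e
    assume A: "A \<in> forms m e" "proj_space m \<inter> nonzero_locus m (Var m) \<subseteq> zero_locus m A"
    have "insertion x (Var m * A) = 0" for x
    proof (cases "x m = 0")
      case False
      then have h: "trunc m x \<in> hcoords m" by (rule trunc_hcoords[rotated]) simp
      have "pt m (trunc m x) \<in> V"
        using False by (simp add: pt_V[OF h]) (simp add: trunc_def)
      then have "insertion (trunc m x) A = 0"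
        using A(2) pt_in_zero_locus[OF A(1) h] by (auto simp: V_def)
      then show ?thesis by (simp add: insertion_trunc[OF A(1)] insertion.hom_mult)
    qed (simp add: insertion.hom_mult)
    then have "Var m * A = 0" using exists_insertion_nonzero[OF inf] by blast
    then have "A = 0" using prime by (auto simp: prime_elem_def)
    then show "proj_space m \<subseteq> zero_locus m A"
      by (auto simp: zero_locus_def insertion.hom_zero)
  qed

  define f :: "nat \<Rightarrow> 'k mpoly" where "f = Var"
  define g :: "nat \<Rightarrow> 'k mpoly" where "g i = (if i \<le> m then Var m ^ q * Var i else - G)" for i
  have f: "f i \<in> forms (Suc m) (Suc 0)" if "i \<le> m" for i
    using that by (simp add: f_def forms_Var)
  have g: "g i \<in> forms m (Suc q)" if "i \<le> Suc m" for i
    using forms_mult[OF forms_Var_power[of m m q] forms_Var[of i m]] forms_uminus[OF G(1)]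
    by (auto simp: g_def)

  have down: "trunc m x \<in> hcoords m" "form_map m f (pt (Suc m) x) = pt m (trunc m x)"
    if "x \<in> hcoords (Suc m)" "x m \<noteq> 0" for x
  proof -
    show h: "trunc m x \<in> hcoords m" using that(2) by (rule trunc_hcoords[rotated]) simp
    show "form_map m f (pt (Suc m) x) = pt m (trunc m x)"
      using form_map_pt[of m f "Suc m" "Suc 0" x] f that(1) h by (simp add: f_def)
  qed
  define lift :: "(nat \<Rightarrow> 'k) \<Rightarrow> nat \<Rightarrow> 'k" where
    "lift y = trunc (Suc m) (\<lambda>i. insertion y (g i))" for y
  have lift: "lift y i = (if i \<le> m then y m ^ q * y i else if i = Suc m then - insertion y G else 0)" for y i
    by (simp add: lift_def trunc_def g_def insertion.hom_mult insertion.hom_power insertion.hom_uminus)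
  have up: "lift y \<in> hcoords (Suc m)" "form_map (Suc m) g (pt m y) = pt (Suc m) (lift y)"
    if "y \<in> hcoords m" "y m \<noteq> 0" for y
  proof -
    show h: "lift y \<in> hcoords (Suc m)"
      using that(2) by (auto simp: hcoords_def lift intro!: exI[of _ m])
    show "form_map (Suc m) g (pt m y) = pt (Suc m) (lift y)"
      using form_map_pt[of "Suc m" g m "Suc q" y] g that(1) h by (simp add: lift_def)
  qed

  have down_V: "form_map m f P \<in> V" and up_down: "form_map (Suc m) g (form_map m f P) = P"
    if "P \<in> U" for P
  proof -
    have "P \<in> proj_space (Suc m)" using that X_sub by (auto simp: U_def)
    then obtain x where x: "x \<in> hcoords (Suc m)" and P: "P = pt (Suc m) x"
      by (auto simp: proj_space_eq)
    have nz: "x m \<noteq> 0" and eq: "insertion x F = 0" using that pt_U[OF x] by (auto simp: P)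
    have tm: "trunc m x m = x m" by (simp add: trunc_def)
    show "form_map m f P \<in> V" using down[OF x nz] nz by (simp add: P pt_V tm)
    have "lift (trunc m x) = (\<lambda>i. x m ^ q * x i)"
    proof
      fix i
      have "i > Suc m \<Longrightarrow> x i = 0" using x by (simp add: hcoords_def)
      moreover have "- insertion x G = x m ^ q * x (Suc m)"
        using eq by (simp add: insF add_eq_0_iff)
      ultimately show "lift (trunc m x) i = x m ^ q * x i"
        unfolding lift insertion_trunc[OF G(1)] tm by (cases "i = Suc m") (auto simp: trunc_def)
    qed
    then show "form_map (Suc m) g (form_map m f P) = P"
      using up[of "trunc m x"] down[OF x nz] nz pt_scale[OF x, of "x m ^ q"] by (simp add: P tm)
  qed

  have up_U: "form_map (Suc m) g Q \<in> U" and down_up: "form_map m f (form_map (Suc m) g Q) = Q"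
    if "Q \<in> V" for Q
  proof -
    have "Q \<in> proj_space m" using that by (auto simp: V_def)
    then obtain y where y: "y \<in> hcoords m" and Q: "Q = pt m y" by (auto simp: proj_space_eq)
    have nz: "y m \<noteq> 0" using that pt_V[OF y] by (simp add: Q)
    have m: "lift y m = y m ^ q * y m" by (simp add: lift)
    have "insertion (lift y) G = insertion (\<lambda>i. y m ^ q * y i) G"
      by (rule insertion_forms_cong[OF G(1)]) (simp add: lift)
    then have "insertion (lift y) F = 0"
      using insertion_forms_scale[OF G(1), of "y m ^ q" y]
      by (simp add: insF lift power_mult_distrib)
    then show "form_map (Suc m) g Q \<in> U"
      using up[OF y nz] nz by (simp add: Q pt_U m)
    have "trunc m (lift y) = (\<lambda>i. y m ^ q * y i)"
      using y by (auto simp: trunc_def lift hcoords_def fun_eq_iff)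
    then show "form_map m f (form_map (Suc m) g Q) = Q"
      using up[OF y nz] down[of "lift y"] nz pt_scale[OF y, of "y m ^ q"] by (simp add: Q m)
  qed

  have "regular_map (Suc m) U m V (form_map m f)"
    by (rule regular_map_form_map[where d = "Suc 0"]) (use X_sub f down_V in \<open>auto simp: U_def\<close>)
  moreover have "regular_map m V (Suc m) U (form_map (Suc m) g)"
    by (rule regular_map_form_map[where d = "Suc q"]) (use g up_U in \<open>auto simp: V_def\<close>)
  ultimately have "birational (Suc m) X m (proj_space m)"
    unfolding birational_def using dense_U dense_V up_down down_up by blast
  then show ?thesis
    using irred by (simp add: rational_hypersurface_def X_def flip: F_def)
qed

section \<open>The equation of \<open>X\<^sub>s\<close>\<close>

text \<open>The contribution of column \<open>j\<close> of the matrix: each column but the last has a single entry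
  \<open>1\<close>, on the diagonal for \<open>j < s\<close> and just below it otherwise.\<close>

definition X_term :: "nat \<Rightarrow> nat \<Rightarrow> nat \<Rightarrow> 'k::comm_ring_1 mpoly" where
  "X_term q s j = (if j < s then Var j * Var j ^ q else Var (Suc j) * Var j ^ q)"

lemma W_mat_entry:
  assumes "s \<le> n" "i \<le> n" "j \<le> n"
  shows "W_mat n s $$ (i, j) = (if i = (if j < s then j else Suc j) then 1 else 0)"
  using assms by (auto simp: W_mat_def E_mat_def)

lemma X_form_eq:
  assumes "s < n"
  shows "X_form q n s = (\<Sum>j<n. X_term q s j :: 'k::comm_ring_1 mpoly)"
proof -
  interpret C: comm_ring_hom "Const :: 'k \<Rightarrow> 'k mpoly" by (rule comm_ring_hom_Const)
  have column: "(\<Sum>i\<le>n. Const (W_mat n s $$ (i, j)) * Var i * Var j ^ q) =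
      (if j < n then X_term q s j else 0 :: 'k mpoly)" if "j \<le> n" for j
  proof -
    define k where "k = (if j < s then j else Suc j)"
    have "(\<Sum>i\<le>n. Const (W_mat n s $$ (i, j)) * Var i * Var j ^ q) =
        (\<Sum>i\<le>n. if i = k then Var k * Var j ^ q else 0 :: 'k mpoly)"
      using assms that by (intro sum.cong) (auto simp: W_mat_entry k_def)
    also have "\<dots> = (if k \<le> n then Var k * Var j ^ q else 0)" by simp
    also have "\<dots> = (if j < n then X_term q s j else 0)"
      using assms that by (auto simp: k_def X_term_def)
    finally show ?thesis .
  qed
  have "X_form q n s = (\<Sum>j\<le>n. \<Sum>i\<le>n. Const (W_mat n s $$ (i, j)) * Var i * Var j ^ q :: 'k mpoly)"
    unfolding X_form_def by (rule sum.swap)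
  also have "\<dots> = (\<Sum>j\<le>n. if j < n then X_term q s j else 0)"
    by (intro sum.cong) (simp_all add: column)
  also have "\<dots> = (\<Sum>j<n. X_term q s j)"
    by (intro sum.mono_neutral_cong_right) auto
  finally show ?thesis .
qed

lemma X_term_forms:
  assumes "j < m"
  shows "(X_term q s j :: 'k::comm_ring_1 mpoly) \<in> forms m (Suc q)"
proof -
  have "(Var i * Var j ^ q :: 'k mpoly) \<in> forms m (Suc q)" if "i \<le> m" for i
    using forms_mult[OF forms_Var[OF that] forms_Var_power[of j m q]] assms by simp
  then show ?thesis using assms by (simp add: X_term_def)
qed

text \<open>It suffices to find a zero of \<open>x\<^sub>m\<close> at which the sum does not vanish. If \<open>s > 0\<close>, the term
  \<open>x\<^sub>0\<^sup>q\<^sup>+\<^sup>1\<close> is singled out by the first unit vector \<open>(1, 0, \<dots>)\<close>; if \<open>s = 0\<close>, the term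
  \<open>x\<^sub>1 x\<^sub>0\<^sup>q\<close> is singled out by \<open>(1, 1, 0, \<dots>)\<close>, which needs \<open>m > 1\<close>.\<close>

lemma Var_not_dvd_X_terms:
  assumes "q > 0" "m > 0" "s > 0 \<or> m > 1"
  shows "\<not> Var m dvd (\<Sum>j<m. X_term q s j :: 'k::comm_ring_1 mpoly)"
proof
  assume "Var m dvd (\<Sum>j<m. X_term q s j :: 'k mpoly)"
  then obtain B where B: "(\<Sum>j<m. X_term q s j :: 'k mpoly) = Var m * B" by blast
  define x :: "nat \<Rightarrow> 'k" where "x i = (if i = 0 \<or> s = 0 \<and> i = 1 then 1 else 0)" for i
  have "x m = 0" using assms by (auto simp: x_def)
  then have "insertion x (\<Sum>j<m. X_term q s j) = 0"
    by (simp add: B insertion.hom_mult)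
  moreover have "insertion x (X_term q s j) = (if j = 0 then 1 else 0)" for j
    using assms(1) by (auto simp: X_term_def x_def insertion.hom_mult insertion.hom_power)
  ultimately show False using assms(2) by (simp add: insertion.hom_sum)
qed

theorem corollary1p4:
  fixes p q e n s :: nat
  assumes "CHAR('k::alg_closed_field) = p" and "p > 0"
    and "e \<ge> 1" and "q = p ^ e"
    and "n \<ge> 2" and "s < n" and "(n, s) \<noteq> (2, 0)"
  shows "rational_hypersurface n (X_form q n s :: 'k mpoly)"
proof -
  obtain m where n: "n = Suc m" using \<open>n \<ge> 2\<close> by (cases n) auto
  let ?G = "\<Sum>j<m. X_term q s j :: 'k mpoly"
  have q: "q > 0" using assms by simp
  have "X_form q n s = Var m ^ q * Var (Suc m) + ?G"
    using assms(6) by (simp add: X_form_eq n X_term_def[of q s m] algebra_simps)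
  moreover have "?G \<in> forms m (Suc q)" by (intro forms_sum X_term_forms) simp
  moreover have "\<not> Var m dvd ?G"
    using assms(5,7) by (intro Var_not_dvd_X_terms[OF q]) (auto simp: n)
  ultimately show ?thesis using rational_hypersurface_linear[OF _ _ q] by (simp add: n)
qed

end
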